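(* Let $n,m,q,L,\phi\in\mathbb{N}$ and consider the linear $\phi$-periodic noisy system $$x(k+1)=A(k)x(k)+B(k)u(k)+d(k),\qquad \zeta(k)=x(k)+v(k),$$ with $A(k)\in\mathbb{R}^{n\times n}$, $B(k)\in\mathbb{R}^{n\times m}$, $A(k+\phi)=A(k)$, $B(k+\phi)=B(k)$ for all $k\ge0$. Let $Z(k)\in\mathbb{R}^{n\times L}$, $k=0,\dots,\phi$, and $U(k)\in\mathbb{R}^{m\times L}$, $k=0,\dots,\phi-1$, be data matrices formed from input-output data of this system, with associated noise matrices $V(k)$, $D(k)$ (see context), and suppose that $$\mathrm{rank}\begin{bmatrix}Z(k)\\ U(k)\end{bmatrix}=n+m,\qquad k=0,\dots,\phi-1.$$ Let the performance output matrices $C(k)\in\mathbb{R}^{q\times n}$, $D_u(k)\in\mathbb{R}^{q\times m}$, $D_d(k)\in\mathbb{R}^{q\times n}$ and the performance index $Q_p(k),S_p(k),R_p(k)$ with $\tilde Q_p(k),\tilde S_p(k),\tilde R_p(k)$ be as in the context, all $\phi$-periodic in $k$. Suppose that $W(k)=A(k)V(k)-V(k+1)-D(k)\in\mathbb{R}^{n\times L}$ satisfies $$\begin{bmatrix}I_n\\ W(k)^\top\end{bmatrix}^\top\begin{bmatrix}Q_r(k)&S_r(k)\\ S_r(k)^\top&R_r(k)\end{bmatrix}\begin{bmatrix}I_n\\ W(k)^\top\end{bmatrix}\succeq0,\qquad k=0,\dots,\phi-1,$$ where $Q_r(k)\in\mathbb{R}^{n\times n}$ is symmetric, $S_r(k)\in\mathbb{R}^{n\times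 L}$, and $R_r(k)\in\mathbb{R}^{L\times L}$ is symmetric with $R_r(k)\prec0$. Let $Y(k)\in\mathbb{R}^{L\times n}$, $M(k)\in\mathbb{R}^{L\times m}$, $k=0,\dots,\phi-1$, and $\mathcal P(k)=\mathcal P(k)^\top\in\mathbb{R}^{n\times n}$, $k=0,\dots,\phi$, be any sequences of matrices satisfying, for $k=0,\dots,\phi-1$, $$\begin{bmatrix} \mathcal P(k+1)-Q_r(k)&\star&\star&\star&\star\\ -\tilde S_p(k)^\top\bar E_{cl}(k)^\top&-D_{cl}(k)\tilde S_p(k)-\tilde S_p(k)^\top D_{cl}(k)^\top+\tilde R_p(k)&\star&\star&\star\\ -S_r(k)^\top&-\bar M(k)\tilde S_p(k)&-R_r(k)&\star&\star\\ \bar E_{cl}(k)^\top&D_{cl}(k)^\top&\bar M(k)^\top&-\tilde Q_p(k)^{-1}&\star\\ \big(Z(k+1)Y(k)\big)^\top&\big(C(k)\mathcal P(k)+D_u(k)U(k)Y(k)\big)^\top&Y(k)^\top&0&\mathcal P(k) \end{bmatrix}\succ0,$$ $$Z(k)Y(k)=\mathcal P(k),\qquad \begin{bmatrix}0\\ I_m\end{bmatrix}=\begin{bmatrix}Z(k)\\ U(k)\end{bmatrix}M(k),$$ and $$\mathcal P(\phi)=\mathcal P(0),$$ where $\bar E_{cl}(k)=[\,Z(k+1)M(k)\ \ I_n\,]$, $\bar M(k)=[\,M(k)\ \ 0\,]\in\mathbb{R}^{L\times(m+n)}$ and $D_{cl}(k)=[\,D_u(k)\ \ D_d(k)\,]$.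 Then, with $$K(k)=U(k)Y(k)\mathcal P(k)^{-1},\quad k=0,\dots,\phi-1,\qquad K(k+n_p\phi)=K(k)\ \text{ for all integers } n_p\ge0,$$ the trajectories of the closed-loop system $$x(k+1)=\big(A(k)+B(k)K(k)\big)x(k)+[\,B(k)\ \ I_n\,]\bar w(k),\qquad z(k)=\big(C(k)+D_u(k)K(k)\big)x(k)+D_{cl}(k)\bar w(k),$$ $k\ge0$, with initial condition $x(0)=0$, satisfy the infinite-horizon quadratic robust performance criterion: there exists $\varepsilon>0$ such that $$\sum_{k=0}^{\infty}\begin{bmatrix}\bar w(k)\\ z(k)\end{bmatrix}^\top\begin{bmatrix}Q_p(k)&S_p(k)\\ S_p(k)^\top&R_p(k)\end{bmatrix}\begin{bmatrix}\bar w(k)\\ z(k)\end{bmatrix}+\varepsilon\sum_{k=0}^{\infty}\bar w(k)^\top\bar w(k)\le0\quad\text{for all }\bar w\in\ell_2.$$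
   Context: $\succ,\succeq,\prec$ refer to the (semi)definite ordering of symmetric matrices; $\star$ denotes blocks inferred by symmetry; $\ell_2$ is the space of square-summable sequences. Performance index: for all $k\ge0$, $Q_p(k)=Q_p(k)^\top\in\mathbb{R}^{(n+m)\times(n+m)}$, $S_p(k)\in\mathbb{R}^{(n+m)\times q}$, $R_p(k)=R_p(k)^\top\in\mathbb{R}^{q\times q}$, $R_p(k)\succeq0$; the matrix $\begin{bmatrix}Q_p(k)&S_p(k)\\ S_p(k)^\top&R_p(k)\end{bmatrix}$ is invertible, with inverse denoted $\begin{bmatrix}\tilde Q_p(k)&\tilde S_p(k)\\ \tilde S_p(k)^\top&\tilde R_p(k)\end{bmatrix}$, and it is assumed that $\tilde Q_p(k)\prec0$. Periodicity of the performance index means $C(k+\phi)=C(k)$, $D_u(k+\phi)=D_u(k)$, $D_d(k+\phi)=D_d(k)$, $Q_p(k+\phi)=Q_p(k)$, $S_p(k+\phi)=S_p(k)$, $R_p(k+\phi)=R_p(k)$ for all $k\ge0$. The closed-loop system arises from performance output $z(k)=C(k)x(k)+D_u(k)u(k)+D_d(k)d(k)$, feedback $u(k)=K(k)\zeta(k)$, and $\bar w(k)=[\,(K(k)v(k))^\top\ \ d(k)^\top\,]^\top\in\mathbb{R}^{m+n}$, which is regarded as an arbitrary disturbance input. Data: for $j=1,\dots,L$, the input $u_{d,j}(k)$ ($k=0,\dots,\phi-1$) and the noisy state measurement $\zeta_{d,j}(k)=x_{d,j}(k)+v_{d,j}(k)$ ($k=0,\dots,\phi$) are recorded, where $x_{d,j}(k+1)=A(k)x_{d,j}(k)+B(k)u_{d,j}(k)+d_{d,j}(k)$;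 the data stem either from an ensemble of $L$ experiments of length $\phi$ or from a single experiment of length $L\phi$ cut into $L$ consecutive periods. The states $x_{d,j}$, measurement noise $v_{d,j}$ and process noise $d_{d,j}$ are not measured. The matrices are $Z(k)=[\zeta_{d,1}(k),\dots,\zeta_{d,L}(k)]$, $U(k)=[u_{d,1}(k),\dots,u_{d,L}(k)]$, $X(k)=[x_{d,1}(k),\dots,x_{d,L}(k)]$, $V(k)=[v_{d,1}(k),\dots,v_{d,L}(k)]$, $D(k)=[d_{d,1}(k),\dots,d_{d,L}(k)]$, so that $X(k+1)=A(k)X(k)+B(k)U(k)+D(k)$ for $k=0,\dots,\phi-1$ and $Z(k)=X(k)+V(k)$ for $k=0,\dots,\phi$. *)

theory Defs
  imports "HOL-Analysis.Analysis"
begin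

text \<open>
  Block vectors and matrices are indexed by sum types: the index type \<open>'a + 'b\<close> lists the
  components of the first block followed by those of the second.
\<close>

definition vappend :: "real^'a \<Rightarrow> real^'b \<Rightarrow> real^('a + 'b)" where
  "vappend x y = (\<chi> i. case i of Inl a \<Rightarrow> x $ a | Inr b \<Rightarrow> y $ b)"

definition hcat :: "real^'c^'r \<Rightarrow> real^'d^'r \<Rightarrow> real^('c + 'd)^'r" where
  "hcat A B = (\<chi> i. vappend (A $ i) (B $ i))"

definition vcat :: "real^'c^'r \<Rightarrow> real^'c^'s \<Rightarrow> real^'c^('r + 's)" where
  "vcat A B = (\<chi> i. case i of Inl a \<Rightarrow> A $ a | Inr b \<Rightarrow> B $ b)"

definition block2 ::
  "real^'c^'r \<Rightarrow> real^'d^'r \<Rightarrow> real^'c^'s \<Rightarrow> real^'d^'s \<Rightarrow> real^('c + 'd)^('r + 's)" where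
  "block2 A B C D = vcat (hcat A B) (hcat C D)"

text \<open>
  Symmetric block matrices given by their lower triangular part; the blocks above the diagonal
  are the transposes of those below it.
\<close>

definition sym_block2 :: "real^'a^'a \<Rightarrow> real^'a^'b \<Rightarrow> real^'b^'b \<Rightarrow> real^('a + 'b)^('a + 'b)" where
  "sym_block2 A\<^sub>1\<^sub>1 A\<^sub>2\<^sub>1 A\<^sub>2\<^sub>2 = block2 A\<^sub>1\<^sub>1 (transpose A\<^sub>2\<^sub>1) A\<^sub>2\<^sub>1 A\<^sub>2\<^sub>2"

definition sym_block5 ::
  "real^'a^'a \<Rightarrow>
   real^'a^'b \<Rightarrow> real^'b^'b \<Rightarrow>
   real^'a^'c \<Rightarrow> real^'b^'c \<Rightarrow> real^'c^'c \<Rightarrow>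
   real^'a^'d \<Rightarrow> real^'b^'d \<Rightarrow> real^'c^'d \<Rightarrow> real^'d^'d \<Rightarrow>
   real^'a^'e \<Rightarrow> real^'b^'e \<Rightarrow> real^'c^'e \<Rightarrow> real^'d^'e \<Rightarrow> real^'e^'e \<Rightarrow>
   real^('a + ('b + ('c + ('d + 'e))))^('a + ('b + ('c + ('d + 'e))))" where
  "sym_block5
     A\<^sub>1\<^sub>1
     A\<^sub>2\<^sub>1 A\<^sub>2\<^sub>2
     A\<^sub>3\<^sub>1 A\<^sub>3\<^sub>2 A\<^sub>3\<^sub>3
     A\<^sub>4\<^sub>1 A\<^sub>4\<^sub>2 A\<^sub>4\<^sub>3 A\<^sub>4\<^sub>4
     A\<^sub>5\<^sub>1 A\<^sub>5\<^sub>2 A\<^sub>5\<^sub>3 A\<^sub>5\<^sub>4 A\<^sub>5\<^sub>5 =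
   sym_block2 A\<^sub>1\<^sub>1 (vcat A\<^sub>2\<^sub>1 (vcat A\<^sub>3\<^sub>1 (vcat A\<^sub>4\<^sub>1 A\<^sub>5\<^sub>1)))
     (sym_block2 A\<^sub>2\<^sub>2 (vcat A\<^sub>3\<^sub>2 (vcat A\<^sub>4\<^sub>2 A\<^sub>5\<^sub>2))
       (sym_block2 A\<^sub>3\<^sub>3 (vcat A\<^sub>4\<^sub>3 A\<^sub>5\<^sub>3)
         (sym_block2 A\<^sub>4\<^sub>4 A\<^sub>5\<^sub>4 A\<^sub>5\<^sub>5)))"

definition of_columns :: "('l \<Rightarrow> real^'n) \<Rightarrow> real^'l^'n" where
  "of_columns f = (\<chi> i j. f j $ i)"

text \<open>
  Semidefinite and definite ordering of symmetric matrices. Symmetry of both sides is part of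
  the relations. The subscript avoids a clash with the cardinality relation \<open>lesspoll\<close>.
\<close>

definition loewner_le :: "real^'n^'n \<Rightarrow> real^'n^'n \<Rightarrow> bool" (infix "\<preceq>\<^sub>L" 50) where
  "A \<preceq>\<^sub>L B \<longleftrightarrow> transpose A = A \<and> transpose B = B \<and> (\<forall>x. 0 \<le> x \<bullet> ((B - A) *v x))"

definition loewner_less :: "real^'n^'n \<Rightarrow> real^'n^'n \<Rightarrow> bool" (infix "\<prec>\<^sub>L" 50) where
  "A \<prec>\<^sub>L B \<longleftrightarrow> transpose A = A \<and> transpose B = B \<and> (\<forall>x. x \<noteq> 0 \<longrightarrow> 0 < x \<bullet> ((B - A) *v x))"

definition quad_form :: "real^'n^'n \<Rightarrow> real^'n \<Rightarrow> real" where
  "quad_form A x = x \<bullet> (A *v x)"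

definition ell2 :: "(nat \<Rightarrow> real^'a) set" where
  "ell2 = {w. summable (\<lambda>k. (norm (w k))\<^sup>2)}"

definition periodic :: "nat \<Rightarrow> (nat \<Rightarrow> 'a) \<Rightarrow> bool" where
  "periodic p f \<longleftrightarrow> (\<forall>k. f (k + p) = f k)"

end

theory Submission
  imports Defs
begin

text \<open>
  The quadratic storage function \<open>V\<^sub>k(x) = x\<^sup>T P(k)\<^sup>-\<^sup>1 x\<close>, with \<open>P\<close> continued periodically, satisfies
  along the closed loop the strict dissipation inequality
  \<open>V\<^sub>k\<^sub>+\<^sub>1(x\<^sup>+) - V\<^sub>k(x) + \<sigma>(w, z) + \<epsilon> (|x|\<^sup>2 + |w|\<^sup>2) \<le> 0\<close>,
  where \<open>\<sigma>\<close> is the quadratic form of the performance index. Telescoping from \<open>x(0) = 0\<close> gives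
  the performance bound for partial sums. To pass to the limit one needs \<open>x \<in> \<ell>\<^sub>2\<close>:
  \<open>R\<^sub>p \<succeq> 0\<close> makes \<open>-\<sigma>\<close> at most a multiple of \<open>|w|\<^sup>2 + |w||x|\<close>, and Young's inequality absorbs
  the mixed term into \<open>\<epsilon>|x|\<^sup>2\<close> (\<open>dissipative_supply_sum\<close>).

  The dissipation inequality comes from the matrix inequality in two moves. First, the data
  satisfy \<open>Z(k+1) + W = A Z + B U\<close>, so the unknown closed loop can be written as
  \<open>A + B K = (Z(k+1) + W) Y P\<^sup>-\<^sup>1\<close> and \<open>B = (Z(k+1) + W) M\<close> (\<open>closed_loop_from_data\<close>); testing
  the matrix inequality on vectors whose third block is \<open>W\<^sup>T p\<close> turns its entries into
  the true closed-loop matrices, and the noise bound has the sign needed to discard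
  \<open>Q\<^sub>r, S\<^sub>r, R\<^sub>r\<close> (\<open>lmi_on_consistent_noise\<close>).

  Second, what remains is a condition on the dual system: it involves \<open>P\<close> and the inverse
  performance index, and one would usually pass to the primal inequality by Schur complements
  followed by the dualization lemma. Both steps are here replaced by one substitution. For given
  \<open>x, w\<close> with successor \<open>x\<^sup>+\<close> and output \<open>z\<close>, the test vector
  \<open>p = -P\<^sub>+\<^sup>-\<^sup>1 x\<^sup>+\<close>, \<open>r = -(S\<^sub>p\<^sup>T w + R\<^sub>p z)\<close>, \<open>s = w + S~\<^sub>p r\<close>, \<open>t = P\<^sup>-\<^sup>1 x\<close>
  makes the dual form equal to \<open>V(x) - V\<^sub>+(x\<^sup>+) - \<sigma>(w, z)\<close> (\<open>storage_decrease_identity\<close>). As \<open>x\<close> and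
  \<open>w\<close> can be recovered linearly from \<open>r, s, t\<close>, strict definiteness yields the \<open>\<epsilon>\<close> term.
\<close>

section \<open>Block vectors and matrices\<close>

lemma sum_UNIV_sum:
  "(\<Sum>i\<in>(UNIV :: ('a::finite + 'b::finite) set). f i) = (\<Sum>a\<in>UNIV. f (Inl a)) + (\<Sum>b\<in>UNIV. f (Inr b))"
  by (simp add: UNIV_Plus_UNIV[symmetric] sum.Plus del: UNIV_Plus_UNIV)

lemma inner_vappend [simp]: "vappend x y \<bullet> vappend x' y' = x \<bullet> x' + y \<bullet> y'"
  by (simp add: vappend_def inner_vec_def sum_UNIV_sum)

lemma norm_vappend_squared: "(norm (vappend x y))\<^sup>2 = (norm x)\<^sup>2 + (norm y)\<^sup>2"
  by (simp add: power2_norm_eq_inner)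

lemma vappend_inject [simp]: "vappend x y = vappend x' y' \<longleftrightarrow> x = x' \<and> y = y'"
  by (auto simp: vappend_def vec_eq_iff split: sum.splits)

lemma vappend_eq_0_iff [simp]: "vappend x y = 0 \<longleftrightarrow> x = 0 \<and> y = 0"
  by (auto simp: vappend_def vec_eq_iff split: sum.splits)

lemma vappend_add: "vappend x y + vappend x' y' = vappend (x + x') (y + y')"
  by (auto simp: vappend_def vec_eq_iff split: sum.splits)

lemma vcat_mult_vec [simp]: "vcat A B *v x = vappend (A *v x) (B *v x)"
  by (auto simp: vappend_def vcat_def vec_eq_iff matrix_vector_mult_def split: sum.splits)

lemma hcat_mult_vappend [simp]: "hcat A B *v vappend x y = A *v x + B *v y"
  by (auto simp: vappend_def hcat_def vec_eq_iff matrix_vector_mult_def sum_UNIV_sum)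

lemma transpose_vcat: "transpose (vcat A B) = hcat (transpose A) (transpose B)"
  by (auto simp: vappend_def vcat_def hcat_def transpose_def vec_eq_iff split: sum.splits)

lemma mult_hcat: "A ** hcat B C = hcat (A ** B) (A ** C)"
  by (auto simp: vappend_def hcat_def matrix_matrix_mult_def vec_eq_iff split: sum.splits)

lemma hcat_add: "hcat A B + hcat A' B' = hcat (A + A') (B + B')"
  by (simp add: hcat_def vec_eq_iff vappend_add)

lemma vcat_mult: "vcat A B ** C = vcat (A ** C) (B ** C)"
  by (auto simp: vcat_def matrix_matrix_mult_def vec_eq_iff split: sum.splits)

lemma vcat_inject [simp]: "vcat A B = vcat A' B' \<longleftrightarrow> A = A' \<and> B = B'"
  by (auto simp: vcat_def vec_eq_iff split: sum.splits)

lemma block2_mult_vappend [simp]: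
  "block2 A B C D *v vappend x y = vappend (A *v x + B *v y) (C *v x + D *v y)"
  by (simp add: block2_def)

lemma inner_transpose: "x \<bullet> (y v* A) = y \<bullet> (A *v x)"
  for A :: "real^'a^'b"
  by (metis dot_lmul_matrix inner_commute)

lemma quad_form_sym_block2:
  "quad_form (sym_block2 A\<^sub>1\<^sub>1 A\<^sub>2\<^sub>1 A\<^sub>2\<^sub>2) (vappend x y)
     = quad_form A\<^sub>1\<^sub>1 x + 2 * (y \<bullet> (A\<^sub>2\<^sub>1 *v x)) + quad_form A\<^sub>2\<^sub>2 y"
  by (simp add: quad_form_def sym_block2_def inner_right_distrib inner_transpose)

section \<open>Definite matrices\<close>

lemma sym_block5_last_block_positive:
  assumes "0 \<prec>\<^sub>L sym_block5 A\<^sub>1\<^sub>1 A\<^sub>2\<^sub>1 A\<^sub>2\<^sub>2 A\<^sub>3\<^sub>1 A\<^sub>3\<^sub>2 A\<^sub>3\<^sub>3 A\<^sub>4\<^sub>1 A\<^sub>4\<^sub>2 A\<^sub>4\<^sub>3 A\<^sub>4\<^sub>4 A\<^sub>5\<^sub>1 A\<^sub>5\<^sub>2 A\<^sub>5\<^sub>3 A\<^sub>5\<^sub>4 A\<^sub>5\<^sub>5"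
    and "x \<noteq> 0"
  shows "0 < quad_form A\<^sub>5\<^sub>5 x"
proof -
  have "0 < quad_form (sym_block5 A\<^sub>1\<^sub>1 A\<^sub>2\<^sub>1 A\<^sub>2\<^sub>2 A\<^sub>3\<^sub>1 A\<^sub>3\<^sub>2 A\<^sub>3\<^sub>3 A\<^sub>4\<^sub>1 A\<^sub>4\<^sub>2 A\<^sub>4\<^sub>3 A\<^sub>4\<^sub>4 A\<^sub>5\<^sub>1 A\<^sub>5\<^sub>2 A\<^sub>5\<^sub>3 A\<^sub>5\<^sub>4 A\<^sub>5\<^sub>5)
      (vappend 0 (vappend 0 (vappend 0 (vappend 0 x))))"
    using assms by (simp add: loewner_less_def quad_form_def)
  then show ?thesis
    by (simp add: sym_block5_def quad_form_sym_block2) (simp add: quad_form_def)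
qed

lemma positive_definite_coercive:
  fixes X :: "real^'a^'a"
  assumes "0 \<prec>\<^sub>L X"
  shows "\<exists>\<delta>>0. \<forall>v. \<delta> * (norm v)\<^sup>2 \<le> quad_form X v"
proof -
  have cont: "continuous_on (sphere 0 1) (quad_form X)"
    unfolding quad_form_def by (intro continuous_intros linear_continuous_on matrix_vector_mul_bounded_linear)
  have ne: "sphere (0::real^'a) 1 \<noteq> {}" by simp
  obtain u where u: "u \<in> sphere 0 1" "\<And>v. v \<in> sphere 0 1 \<Longrightarrow> quad_form X u \<le> quad_form X v"
    using continuous_attains_inf[OF compact_sphere ne cont] by blast
  have "u \<noteq> 0" using u(1) by auto
  then have pos: "0 < quad_form X u" using assms by (simp add: loewner_less_def quad_form_def)
  have "quad_form X u * (norm v)\<^sup>2 \<le> quad_form X v" for v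
  proof (cases "v = 0")
    case True then show ?thesis by (simp add: quad_form_def)
  next
    case False
    define e where "e = v /\<^sub>R norm v"
    have "e \<in> sphere 0 1" using False by (simp add: e_def)
    have "quad_form X v = (norm v)\<^sup>2 * quad_form X e"
      using False by (simp add: quad_form_def e_def matrix_vector_mult_scaleR power2_eq_square field_simps)
    then show ?thesis using u(2)[OF \<open>e \<in> sphere 0 1\<close>]
      by (simp add: mult.commute[of "(norm v)\<^sup>2"] mult_right_mono)
  qed
  then show ?thesis using pos by blast
qed

lemma invertible_matrix_inv:
  fixes X :: "real^'a^'a"
  assumes "invertible X"
  shows "X ** matrix_inv X = mat 1" "matrix_inv X ** X = mat 1"
  using assms someI_ex[of "\<lambda>X'. X ** X' = mat 1 \<and> X' ** X = mat 1"]
  by (auto simp: invertible_def matrix_inv_def)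

lemma invertible_if_definite:
  fixes X :: "real^'a^'a"
  assumes "\<And>x. x \<noteq> 0 \<Longrightarrow> quad_form X x \<noteq> 0"
  shows "invertible X"
proof -
  have "\<forall>x. X *v x = 0 \<longrightarrow> x = 0" using assms by (force simp: quad_form_def)
  then show ?thesis
    using invertible_left_inverse matrix_left_invertible_ker by blast
qed

lemma mult_inverse_vec:
  fixes A B :: "real^'a^'a"
  assumes "A ** B = mat 1"
  shows "A *v (B *v x) = x"
  using assms by (simp add: matrix_vector_mul_assoc)

lemma norm_mult_vec_bound:
  fixes A :: "real^'a^'b"
  shows "\<exists>\<kappa>\<ge>0. \<forall>x. norm (A *v x) \<le> \<kappa> * norm x"
  using bounded_linear.nonneg_bounded[OF matrix_vector_mul_bounded_linear[of A]]
  by (metis mult.commute)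

lemma mult_matrix_add_rdistrib: "(A + B) ** C = A ** C + B ** C" for A B :: "real^'a^'b"
  by (simp add: matrix_matrix_mult_def vec_eq_iff sum.distrib distrib_right)

lemma matrix_vec_uminus: "(- A) *v x = - (A *v x)" for A :: "real^'a^'b"
  by (simp add: matrix_vector_mult_def vec_eq_iff sum_negf)

lemma vec_uminus: "A *v (- x) = - (A *v x)" for A :: "real^'a^'b"
  by (simp add: matrix_vector_mult_def vec_eq_iff sum_negf)

section \<open>From the matrix inequality to the dissipation inequality\<close>

text \<open>
  The choice \<open>W\<^sup>T p\<close> in the third block merges the noise-dependent terms with the nominal
  ones: \<open>E\<close> becomes \<open>E + W N\<close> and \<open>F\<close> becomes \<open>F + W Y\<close>. The terms in \<open>Q, S, R\<close> collect to the
  negative of the noise form at \<open>p\<close>, so dropping them can only increase the value.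
\<close>
lemma lmi_on_consistent_noise:
  fixes Pn Q :: "real^'n^'n" and S W :: "real^'l^'n" and R :: "real^'l^'l"
    and St :: "real^'q^'w" and E :: "real^'w^'n" and N :: "real^'w^'l" and Dc :: "real^'w^'q"
    and T :: "real^'q^'q" and H :: "real^'w^'w"
    and F P :: "real^'n^'n" and G :: "real^'n^'q" and Y :: "real^'n^'l"
  assumes noise: "0 \<preceq>\<^sub>L transpose (vcat (mat 1) (transpose W)) ** block2 Q S (transpose S) R
             ** vcat (mat 1) (transpose W)"
  shows "quad_form (sym_block5
             (Pn - Q)
             (- (transpose St ** transpose E)) T
             (- transpose S) (- (N ** St)) (- R)
             (transpose E) (transpose Dc) (transpose N) H
             (transpose F) (transpose G) (transpose Y) 0 P)
           (vappend p (vappend r (vappend (transpose W *v p) (vappend s t))))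
         \<le> quad_form Pn p + quad_form T r + quad_form H s + quad_form P t
           + 2 * (p \<bullet> ((E + W ** N) *v (s - St *v r))) + 2 * (r \<bullet> (Dc *v s))
           + 2 * (p \<bullet> ((F + W ** Y) *v t)) + 2 * (r \<bullet> (G *v t))"
proof -
  define v where "v = transpose W *v p"
  have "0 \<le> p \<bullet> ((transpose (vcat (mat 1) (transpose W)) ** block2 Q S (transpose S) R
             ** vcat (mat 1) (transpose W)) *v p)"
    using noise by (simp add: loewner_le_def)
  moreover have "p \<bullet> (W *v (p v* S)) = p \<bullet> (S *v (p v* W))"
    by (metis dot_lmul_matrix inner_transpose)
  ultimately have "0 \<le> p \<bullet> (Q *v p) + 2 * (v \<bullet> (transpose S *v p)) + v \<bullet> (R *v v)"
    by (simp add: matrix_vector_mul_assoc[symmetric] transpose_vcat inner_right_distrib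
      matrix_vector_right_distrib inner_transpose v_def dot_lmul_matrix)
  then show ?thesis
    by (simp add: sym_block5_def quad_form_sym_block2 v_def[symmetric])
      (simp add: quad_form_def matrix_vec_uminus matrix_vector_mult_diff_rdistrib
      matrix_vector_mult_add_rdistrib matrix_vector_mult_diff_distrib inner_right_distrib inner_diff_right
      matrix_vector_mul_assoc[symmetric] inner_transpose v_def dot_lmul_matrix)
qed

text \<open>
  With \<open>y = Q w + S z\<close>, the vectors \<open>(y, -r)\<close> and \<open>(w, z)\<close> correspond under the performance index
  and its inverse, so that \<open>s = Qt y\<close>. Hence \<open>s\<^sup>T Qt\<^sup>-\<^sup>1 s\<close>
  is \<open>y\<^sup>T Qt y\<close>, and together with the terms in \<open>St\<close> and \<open>Rt\<close> it rebuilds the form of the index at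
  \<open>(w, z)\<close>. The terms in \<open>p\<close> sum to \<open>V\<^sub>+(x\<^sup>+) - 2 V\<^sub>+(x\<^sup>+)\<close>, since the cross terms produce
  \<open>2 p \<bullet> x\<^sup>+\<close>.
\<close>
lemma storage_decrease_identity:
  fixes Pn Pni P P' Ac :: "real^'n^'n" and Bc :: "real^'w^'n" and Cc :: "real^'n^'q"
    and Dc :: "real^'w^'q" and Q Qt Qti :: "real^'w^'w" and S St :: "real^'q^'w" and R Rt :: "real^'q^'q"
  assumes inverse: "block2 Qt St (transpose St) Rt ** block2 Q S (transpose S) R = mat 1"
    and Qti: "Qti ** Qt = mat 1"
    and Pni: "Pn ** Pni = mat 1"
    and P': "P ** P' = mat 1"
    and xn: "xn = Ac *v x + Bc *v w" and z: "z = Cc *v x + Dc *v w"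
    and p: "p = - (Pni *v xn)" and r: "r = - (transpose S *v w + R *v z)"
    and s: "s = w + St *v r" and t: "t = P' *v x"
  shows "quad_form Pn p + quad_form (- (Dc ** St) - transpose St ** transpose Dc + Rt) r
       + quad_form (- Qti) s + quad_form P t
       + 2 * (p \<bullet> (Bc *v (s - St *v r))) + 2 * (r \<bullet> (Dc *v s))
       + 2 * (p \<bullet> (Ac *v x)) + 2 * (r \<bullet> (Cc *v x))
     = x \<bullet> (P' *v x) - xn \<bullet> (Pni *v xn)
       - quad_form (block2 Q S (transpose S) R) (vappend w z)"
proof -
  define y where "y = Q *v w + S *v z"
  have "block2 Qt St (transpose St) Rt *v (block2 Q S (transpose S) R *v vappend w z) = vappend w z"
    using inverse by (simp only: matrix_vector_mul_assoc matrix_vector_mul_lid)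
  then have wz: "Qt *v y - St *v r = w" "transpose St *v y - Rt *v r = z"
    by (simp_all add: y_def r matrix_vector_right_distrib vec_uminus algebra_simps)
  have s': "s = Qt *v y" using s wz(1) by (simp add: algebra_simps)
  have 1: "quad_form (- Qti) s = - (y \<bullet> s)"
    by (simp add: quad_form_def s' mult_inverse_vec[OF Qti] matrix_vec_uminus inner_commute)
  have 2: "y \<bullet> s = y \<bullet> w + r \<bullet> (transpose St *v y)"
    by (simp add: s inner_right_distrib inner_transpose)
  have 3: "r \<bullet> (transpose St *v y) = r \<bullet> z + r \<bullet> (Rt *v r)"
    using wz(2) by (metis diff_add_cancel inner_right_distrib)
  have 4: "quad_form (block2 Q S (transpose S) R) (vappend w z) = w \<bullet> y - r \<bullet> z"
    by (simp add: quad_form_def y_def r inner_commute inner_diff_right inner_right_distrib)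
  have 5: "p \<bullet> (Bc *v (s - St *v r)) + p \<bullet> (Ac *v x) = - (xn \<bullet> (Pni *v xn))"
  proof -
    have "p \<bullet> (Bc *v (s - St *v r)) + p \<bullet> (Ac *v x) = p \<bullet> xn" by (simp add: s xn inner_right_distrib)
    then show ?thesis by (simp add: p inner_commute)
  qed
  have 6: "r \<bullet> (Dc *v s) + r \<bullet> (Cc *v x) = r \<bullet> z + r \<bullet> (Dc *v (St *v r))"
    by (simp add: s z inner_right_distrib matrix_vector_right_distrib)
  have 7: "quad_form (- (Dc ** St) - transpose St ** transpose Dc + Rt) r
      = - 2 * (r \<bullet> (Dc *v (St *v r))) + r \<bullet> (Rt *v r)"
    by (simp add: quad_form_def matrix_vec_uminus matrix_vector_mult_diff_rdistrib
      matrix_vector_mult_add_rdistrib inner_right_distrib inner_diff_right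
      matrix_vector_mul_assoc[symmetric] inner_transpose dot_lmul_matrix)
  have 8: "quad_form Pn p = xn \<bullet> (Pni *v xn)"
    by (simp add: quad_form_def p vec_uminus mult_inverse_vec[OF Pni] inner_commute)
  have 9: "quad_form P t = x \<bullet> (P' *v x)"
    by (simp add: quad_form_def t mult_inverse_vec[OF P'] inner_commute)
  show ?thesis using 1 2 3 4 5 6 7 8 9 by (simp add: inner_commute)
qed

text \<open>
  The inverse relations \<open>x = P t\<close> and \<open>w = s - St r\<close> bound \<open>|x|\<^sup>2 + |w|\<^sup>2\<close> by a multiple of the squared
  norm of the test vector, so the coercivity of the matrix inequality survives in the
  variables \<open>x, w\<close>.
\<close>
lemma robust_dissipation:
  fixes Pn P Ac :: "real^'n^'n" and Bc :: "real^'w^'n" and Cc :: "real^'n^'q"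
    and Dc :: "real^'w^'q" and Q Qt :: "real^'w^'w" and S St :: "real^'q^'w" and R Rt :: "real^'q^'q"
    and Qr F :: "real^'n^'n" and Sr W :: "real^'l^'n" and Rr :: "real^'l^'l"
    and E :: "real^'w^'n" and N :: "real^'w^'l" and G :: "real^'n^'q" and Y :: "real^'n^'l"
  assumes inverse: "block2 Qt St (transpose St) Rt ** block2 Q S (transpose S) R = mat 1"
    and Qt: "Qt \<prec>\<^sub>L 0"
    and Pn: "Pn ** matrix_inv Pn = mat 1"
    and P: "P ** matrix_inv P = mat 1"
    and noise: "0 \<preceq>\<^sub>L transpose (vcat (mat 1) (transpose W)) ** block2 Qr Sr (transpose Sr) Rr
             ** vcat (mat 1) (transpose W)"
    and lmi: "0 \<prec>\<^sub>L sym_block5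
             (Pn - Qr)
             (- (transpose St ** transpose E)) (- (Dc ** St) - transpose St ** transpose Dc + Rt)
             (- transpose Sr) (- (N ** St)) (- Rr)
             (transpose E) (transpose Dc) (transpose N) (- matrix_inv Qt)
             (transpose F) (transpose G) (transpose Y) 0 P"
    and Bc: "Bc = E + W ** N" and Ac: "Ac ** P = F + W ** Y" and Cc: "Cc ** P = G"
  shows "\<exists>\<epsilon>>0. \<forall>x w.
      (Ac *v x + Bc *v w) \<bullet> (matrix_inv Pn *v (Ac *v x + Bc *v w)) - x \<bullet> (matrix_inv P *v x)
      + quad_form (block2 Q S (transpose S) R) (vappend w (Cc *v x + Dc *v w))
      + \<epsilon> * ((norm x)\<^sup>2 + (norm w)\<^sup>2) \<le> 0"
proof -
  obtain \<delta> where \<delta>: "\<delta> > 0" "\<And>v. \<delta> * (norm v)\<^sup>2 \<le> quad_form (sym_block5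
             (Pn - Qr)
             (- (transpose St ** transpose E)) (- (Dc ** St) - transpose St ** transpose Dc + Rt)
             (- transpose Sr) (- (N ** St)) (- Rr)
             (transpose E) (transpose Dc) (transpose N) (- matrix_inv Qt)
             (transpose F) (transpose G) (transpose Y) 0 P) v"
    using positive_definite_coercive[OF lmi] by blast
  obtain \<kappa>\<^sub>1 where \<kappa>\<^sub>1: "\<kappa>\<^sub>1 \<ge> 0" "\<And>y. norm (P *v y) \<le> \<kappa>\<^sub>1 * norm y" using norm_mult_vec_bound by blast
  obtain \<kappa>\<^sub>2 where \<kappa>\<^sub>2: "\<kappa>\<^sub>2 \<ge> 0" "\<And>y. norm (St *v y) \<le> \<kappa>\<^sub>2 * norm y" using norm_mult_vec_bound by blast
  have Qti: "matrix_inv Qt ** Qt = mat 1"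
    using Qt by (intro invertible_matrix_inv invertible_if_definite) (force simp: quad_form_def loewner_less_def matrix_vec_uminus)
  define \<epsilon> where "\<epsilon> = \<delta> / (2 + \<kappa>\<^sub>1\<^sup>2 + 2 * \<kappa>\<^sub>2\<^sup>2)"
  have den: "0 < 2 + \<kappa>\<^sub>1\<^sup>2 + 2 * \<kappa>\<^sub>2\<^sup>2" by (simp add: add_pos_nonneg)
  have "(Ac *v x + Bc *v w) \<bullet> (matrix_inv Pn *v (Ac *v x + Bc *v w)) - x \<bullet> (matrix_inv P *v x)
      + quad_form (block2 Q S (transpose S) R) (vappend w (Cc *v x + Dc *v w))
      + \<epsilon> * ((norm x)\<^sup>2 + (norm w)\<^sup>2) \<le> 0" for x w
  proof -
    define xn where "xn = Ac *v x + Bc *v w"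
    define z where "z = Cc *v x + Dc *v w"
    define p where "p = - (matrix_inv Pn *v xn)"
    define r where "r = - (transpose S *v w + R *v z)"
    define s where "s = w + St *v r"
    define t where "t = matrix_inv P *v x"
    (* The substitution is invertible in the variables that matter. *)
    have x: "x = P *v t" by (simp add: t_def mult_inverse_vec[OF P])
    have w: "w = s - St *v r" by (simp add: s_def)
    have Acx: "(F + W ** Y) *v t = Ac *v x" and Ccx: "G *v t = Cc *v x"
      by (simp_all add: Ac[symmetric] Cc[symmetric] matrix_vector_mul_assoc[symmetric] x[symmetric])
    have "\<delta> * ((norm r)\<^sup>2 + (norm s)\<^sup>2 + (norm t)\<^sup>2)
        \<le> \<delta> * (norm (vappend p (vappend r (vappend (transpose W *v p) (vappend s t)))))\<^sup>2"
      using \<delta>(1) by (simp add: norm_vappend_squared)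
    also have "\<dots> \<le> x \<bullet> (matrix_inv P *v x) - xn \<bullet> (matrix_inv Pn *v xn)
       - quad_form (block2 Q S (transpose S) R) (vappend w z)"
      using order_trans[OF \<delta>(2) lmi_on_consistent_noise[OF noise], of p r s t]
        storage_decrease_identity[OF inverse Qti Pn P xn_def z_def p_def r_def s_def t_def]
      unfolding Bc[symmetric] Acx Ccx by linarith
    finally have decrease: "\<delta> * ((norm r)\<^sup>2 + (norm s)\<^sup>2 + (norm t)\<^sup>2)
      \<le> x \<bullet> (matrix_inv P *v x) - xn \<bullet> (matrix_inv Pn *v xn)
       - quad_form (block2 Q S (transpose S) R) (vappend w z)" .
    have "(norm x)\<^sup>2 \<le> \<kappa>\<^sub>1\<^sup>2 * (norm t)\<^sup>2"
      using power_mono[OF \<kappa>\<^sub>1(2)[of t], of 2] by (simp add: x power_mult_distrib)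
    moreover have "(norm w)\<^sup>2 \<le> 2 * (norm s)\<^sup>2 + 2 * (\<kappa>\<^sub>2\<^sup>2 * (norm r)\<^sup>2)"
    proof -
      have "norm w \<le> norm s + \<kappa>\<^sub>2 * norm r"
        using norm_triangle_ineq4[of s "St *v r"] \<kappa>\<^sub>2(2)[of r] by (simp add: w)
      then have "(norm w)\<^sup>2 \<le> (norm s + \<kappa>\<^sub>2 * norm r)\<^sup>2" by (simp add: power_mono)
      also have "\<dots> \<le> 2 * (norm s)\<^sup>2 + 2 * (\<kappa>\<^sub>2 * norm r)\<^sup>2"
        using sum_squares_bound[of "norm s" "\<kappa>\<^sub>2 * norm r"] by (simp add: power2_sum)
      finally show ?thesis by (simp add: power_mult_distrib)
    qed
    ultimately have "(norm x)\<^sup>2 + (norm w)\<^sup>2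
        \<le> (2 + \<kappa>\<^sub>1\<^sup>2 + 2 * \<kappa>\<^sub>2\<^sup>2) * ((norm r)\<^sup>2 + (norm s)\<^sup>2 + (norm t)\<^sup>2)"
      by (simp add: algebra_simps) (smt (verit) zero_le_power2 mult_nonneg_nonneg)
    then have "\<epsilon> * ((norm x)\<^sup>2 + (norm w)\<^sup>2) \<le> \<delta> * ((norm r)\<^sup>2 + (norm s)\<^sup>2 + (norm t)\<^sup>2)"
      using den \<delta>(1) by (simp add: \<epsilon>_def divide_simps mult.assoc mult.commute mult_left_mono)
    then show ?thesis using decrease by (simp add: xn_def z_def)
  qed
  moreover have "\<epsilon> > 0" using \<delta>(1) den by (simp add: \<epsilon>_def)
  ultimately show ?thesis by blast
qed

section \<open>Summing the dissipation inequality\<close>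

text \<open>
  Positive semidefiniteness of \<open>R\<close> removes the pure \<open>z\<close> term from the upper bound on the negated
  supply rate, which is why that bound contains no \<open>|x|\<^sup>2\<close>.
\<close>
lemma supply_rate_bounds:
  fixes Q :: "real^'w^'w" and S :: "real^'q^'w" and R :: "real^'q^'q"
    and Cc :: "real^'n^'q" and Dc :: "real^'w^'q"
  assumes R: "0 \<preceq>\<^sub>L R"
  shows "\<exists>c\<ge>0. \<forall>x w.
      - quad_form (block2 Q S (transpose S) R) (vappend w (Cc *v x + Dc *v w))
        \<le> c * ((norm w)\<^sup>2 + norm w * norm x) \<and>
      \<bar>quad_form (block2 Q S (transpose S) R) (vappend w (Cc *v x + Dc *v w))\<bar>
        \<le> c * ((norm x)\<^sup>2 + (norm w)\<^sup>2)"
proof -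
  obtain \<kappa>q where \<kappa>q: "\<kappa>q \<ge> 0" "\<And>y. norm (Q *v y) \<le> \<kappa>q * norm y" using norm_mult_vec_bound by blast
  obtain \<kappa>s where \<kappa>s: "\<kappa>s \<ge> 0" "\<And>y. norm (S *v y) \<le> \<kappa>s * norm y" using norm_mult_vec_bound by blast
  obtain \<kappa>r where \<kappa>r: "\<kappa>r \<ge> 0" "\<And>y. norm (R *v y) \<le> \<kappa>r * norm y" using norm_mult_vec_bound by blast
  obtain \<kappa>c where \<kappa>c: "\<kappa>c \<ge> 0" "\<And>y. norm (Cc *v y) \<le> \<kappa>c * norm y" using norm_mult_vec_bound by blast
  obtain \<kappa>d where \<kappa>d: "\<kappa>d \<ge> 0" "\<And>y. norm (Dc *v y) \<le> \<kappa>d * norm y" using norm_mult_vec_bound by blast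
  define \<kappa> where "\<kappa> = \<kappa>q + \<kappa>s + \<kappa>r"
  define \<mu> where "\<mu> = \<kappa>c + \<kappa>d"
  define c where "c = \<kappa> + 2 * \<kappa> * \<mu> + 2 * \<kappa> * (1 + \<mu>)\<^sup>2"
  have nonneg: "\<kappa> \<ge> 0" "\<mu> \<ge> 0" "c \<ge> 0" using \<kappa>q \<kappa>s \<kappa>r \<kappa>c \<kappa>d by (simp_all add: \<kappa>_def \<mu>_def c_def)
  have "- quad_form (block2 Q S (transpose S) R) (vappend w (Cc *v x + Dc *v w))
        \<le> c * ((norm w)\<^sup>2 + norm w * norm x) \<and>
      \<bar>quad_form (block2 Q S (transpose S) R) (vappend w (Cc *v x + Dc *v w))\<bar>
        \<le> c * ((norm x)\<^sup>2 + (norm w)\<^sup>2)" for x w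
  proof -
    define z where "z = Cc *v x + Dc *v w"
    define a b d where "a = norm x" and "b = norm w" and "d = norm z"
    have abd: "a \<ge> 0" "b \<ge> 0" "d \<ge> 0" by (simp_all add: a_def b_def d_def)
    have form: "quad_form (block2 Q S (transpose S) R) (vappend w z)
        = w \<bullet> (Q *v w) + 2 * (w \<bullet> (S *v z)) + z \<bullet> (R *v z)"
      by (simp add: quad_form_def inner_right_distrib inner_transpose)
    have d: "d \<le> \<mu> * (a + b)"
    proof -
      have "d \<le> \<kappa>c * a + \<kappa>d * b"
        using norm_triangle_ineq[of "Cc *v x" "Dc *v w"] \<kappa>c(2)[of x] \<kappa>d(2)[of w]
        by (simp add: d_def z_def a_def b_def)
      also have "\<dots> \<le> \<mu> * (a + b)" using abd \<kappa>c(1) \<kappa>d(1) by (simp add: \<mu>_def algebra_simps)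
      finally show ?thesis .
    qed
    have bound: "\<bar>u \<bullet> (X *v y)\<bar> \<le> \<kappa> * (norm u * norm y)"
      if "\<And>y. norm (X *v y) \<le> k * norm y" "k \<le> \<kappa>" for X :: "real^'i^'j" and u y k
    proof -
      have "\<bar>u \<bullet> (X *v y)\<bar> \<le> norm u * norm (X *v y)" by (rule Cauchy_Schwarz_ineq2)
      also have "\<dots> \<le> norm u * (\<kappa> * norm y)"
        by (intro mult_left_mono order_trans[OF that(1)] mult_right_mono that(2)) simp_all
      finally show ?thesis by (simp add: algebra_simps)
    qed
    have Q: "\<bar>w \<bullet> (Q *v w)\<bar> \<le> \<kappa> * (b * b)"
      using bound[OF \<kappa>q(2), of w w] \<kappa>s(1) \<kappa>r(1) by (simp add: b_def \<kappa>_def)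
    have S: "\<bar>w \<bullet> (S *v z)\<bar> \<le> \<kappa> * (b * d)"
      using bound[OF \<kappa>s(2), of w z] \<kappa>q(1) \<kappa>r(1) by (simp add: b_def d_def \<kappa>_def)
    have R': "\<bar>z \<bullet> (R *v z)\<bar> \<le> \<kappa> * (d * d)"
      using bound[OF \<kappa>r(2), of z z] \<kappa>q(1) \<kappa>s(1) by (simp add: d_def \<kappa>_def)
    have "0 \<le> z \<bullet> (R *v z)" using R by (simp add: loewner_le_def)
    then have "- quad_form (block2 Q S (transpose S) R) (vappend w z) \<le> \<kappa> * (b * b) + 2 * (\<kappa> * (b * d))"
      using Q S unfolding form by linarith
    also have "\<dots> \<le> \<kappa> * (b * b) + 2 * (\<kappa> * (b * (\<mu> * (a + b))))"
      using nonneg abd d by (intro add_left_mono mult_left_mono) auto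
    also have "\<dots> = \<kappa> * b\<^sup>2 + 2 * \<kappa> * \<mu> * (b\<^sup>2 + b * a)" by (simp add: algebra_simps power2_eq_square)
    also have "\<dots> \<le> \<kappa> * (b\<^sup>2 + b * a) + 2 * \<kappa> * \<mu> * (b\<^sup>2 + b * a) + 2 * \<kappa> * (1 + \<mu>)\<^sup>2 * (b\<^sup>2 + b * a)"
      using nonneg abd by (simp add: distrib_left)
    also have "\<dots> = c * (b\<^sup>2 + b * a)" by (simp add: c_def algebra_simps)
    finally have lower: "- quad_form (block2 Q S (transpose S) R) (vappend w z) \<le> c * (b\<^sup>2 + b * a)" .
    have "\<bar>quad_form (block2 Q S (transpose S) R) (vappend w z)\<bar>
        \<le> \<kappa> * (b * b) + 2 * (\<kappa> * (b * d)) + \<kappa> * (d * d)"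
      using Q S R' unfolding form by linarith
    also have "\<dots> = \<kappa> * (b + d)\<^sup>2" by (simp add: power2_eq_square algebra_simps)
    also have "\<dots> \<le> \<kappa> * ((1 + \<mu>) * (a + b))\<^sup>2"
      using nonneg abd d by (intro mult_left_mono power_mono) (auto simp: distrib_right)
    also have "\<dots> \<le> \<kappa> * ((1 + \<mu>)\<^sup>2 * (2 * (a\<^sup>2 + b\<^sup>2)))"
      unfolding power_mult_distrib using nonneg sum_squares_bound[of a b]
      by (intro mult_left_mono) (auto simp: power2_sum)
    also have "\<dots> \<le> c * (a\<^sup>2 + b\<^sup>2)"
      using nonneg by (simp add: c_def algebra_simps)
    finally show ?thesis using lower by (simp add: z_def a_def b_def)
  qed
  then show ?thesis using nonneg(3) by blast
qed

text \<open>
  In the application \<open>s\<close> is the supply rate along a trajectory, \<open>v\<close> the storage, and \<open>a\<close> and \<open>b\<close>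
  are the norms of state and disturbance. Half of the \<open>\<epsilon> a\<^sup>2\<close> term pays for the mixed term
  \<open>c b a\<close>; the other half shows that \<open>a\<close> is square summable, after which \<open>s\<close> is absolutely summable.
\<close>
lemma dissipative_supply_sum:
  fixes s v a b :: "nat \<Rightarrow> real"
  assumes "\<epsilon> > 0" and c: "c \<ge> 0"
    and v: "v 0 = 0" "\<And>k. v k \<ge> 0"
    and dissipation: "\<And>k. v (Suc k) - v k + s k + \<epsilon> * ((a k)\<^sup>2 + (b k)\<^sup>2) \<le> 0"
    and lower: "\<And>k. - s k \<le> c * ((b k)\<^sup>2 + b k * a k)"
    and bound: "\<And>k. \<bar>s k\<bar> \<le> c * ((a k)\<^sup>2 + (b k)\<^sup>2)"
    and b: "summable (\<lambda>k. (b k)\<^sup>2)"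
  shows "summable s \<and> suminf s + \<epsilon> * (\<Sum>k. (b k)\<^sup>2) \<le> 0"
proof -
  define C where "C = c + c\<^sup>2 / (2 * \<epsilon>)"
  have C: "C \<ge> 0" using c \<open>\<epsilon> > 0\<close> by (simp add: C_def)
  have step: "\<epsilon> / 2 * (a k)\<^sup>2 \<le> C * (b k)\<^sup>2 + (v k - v (Suc k))" for k
  proof -
    have "0 \<le> (\<epsilon> * a k - c * b k)\<^sup>2 / (2 * \<epsilon>)" using \<open>\<epsilon> > 0\<close> by simp
    also have "\<dots> = \<epsilon> / 2 * (a k)\<^sup>2 - c * (b k * a k) + c\<^sup>2 / (2 * \<epsilon>) * (b k)\<^sup>2"
      using \<open>\<epsilon> > 0\<close> by (simp add: power2_eq_square field_simps)
    finally have young: "c * (b k * a k) \<le> \<epsilon> / 2 * (a k)\<^sup>2 + c\<^sup>2 / (2 * \<epsilon>) * (b k)\<^sup>2" by simp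
    have "0 \<le> \<epsilon> * (b k)\<^sup>2" using \<open>\<epsilon> > 0\<close> by simp
    then show ?thesis using young dissipation[of k] lower[of k]
      unfolding C_def by (simp add: algebra_simps)
  qed
  have "summable (\<lambda>k. \<epsilon> / 2 * (a k)\<^sup>2)"
  proof (rule summableI_nonneg_bounded)
    fix n
    have "(\<Sum>k<n. \<epsilon> / 2 * (a k)\<^sup>2) \<le> (\<Sum>k<n. C * (b k)\<^sup>2 + (v k - v (Suc k)))"
      by (intro sum_mono step)
    also have "\<dots> = C * (\<Sum>k<n. (b k)\<^sup>2) - v n"
      using v(1) by (simp add: sum.distrib sum_distrib_left sum_lessThan_telescope')
    also have "\<dots> \<le> C * (\<Sum>k. (b k)\<^sup>2)"
      using v(2)[of n] mult_left_mono[OF sum_le_suminf[OF b, of "{..<n}"] C] by simp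
    finally show "(\<Sum>k<n. \<epsilon> / 2 * (a k)\<^sup>2) \<le> C * (\<Sum>k. (b k)\<^sup>2)" .
  qed (use \<open>\<epsilon> > 0\<close> in simp)
  then have "summable (\<lambda>k. (a k)\<^sup>2)" using \<open>\<epsilon> > 0\<close> by simp
  then have "summable (\<lambda>k. c * ((a k)\<^sup>2 + (b k)\<^sup>2))" using b by (intro summable_mult summable_add)
  then have s: "summable s" by (rule summable_comparison_test') (use bound in simp)
  have "(\<Sum>k<n. s k + \<epsilon> * (b k)\<^sup>2) \<le> 0" for n
  proof -
    have "s k + \<epsilon> * (b k)\<^sup>2 \<le> v k - v (Suc k)" for k
    proof -
      have "0 \<le> \<epsilon> * (a k)\<^sup>2" using \<open>\<epsilon> > 0\<close> by simp
      then show ?thesis using dissipation[of k] unfolding distrib_left by linarith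
    qed
    then have "(\<Sum>k<n. s k + \<epsilon> * (b k)\<^sup>2) \<le> (\<Sum>k<n. v k - v (Suc k))" by (intro sum_mono)
    also have "\<dots> \<le> 0" using v by (simp add: sum_lessThan_telescope')
    finally show ?thesis .
  qed
  then have "(\<Sum>k. s k + \<epsilon> * (b k)\<^sup>2) \<le> 0"
    by (intro suminf_le_const summable_add s summable_mult b)
  then show ?thesis using s b by (simp add: suminf_add[symmetric] suminf_mult summable_mult)
qed

section \<open>Closed loop in terms of the data\<close>

lemma mult_of_columns: "A ** of_columns f = of_columns (\<lambda>j. A *v f j)"
  by (simp add: of_columns_def vec_eq_iff matrix_matrix_mult_def matrix_vector_mult_def)


text \<open>
  Replacing the unmeasured states by their noisy measurements leaves an error that consists
  exactly of \<open>W\<close>.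
\<close>
lemma noisy_data_equation:
  assumes "\<And>j. x' j = A *v x j + B *v u j + d j"
    and "\<And>j. \<zeta> j = x j + v j" and "\<And>j. \<zeta>' j = x' j + v' j"
    and W: "W = A ** of_columns v - of_columns v' - of_columns d"
  shows "of_columns \<zeta>' + W = A ** of_columns \<zeta> + B ** of_columns u"
  unfolding W mult_of_columns
  by (simp add: of_columns_def vec_eq_iff assms(1-3) matrix_vector_right_distrib)

text \<open>
  \<open>Y\<close> and \<open>M\<close> are preimages under the data: \<open>Z Y = P\<close> and \<open>U Y = K P\<close>, while \<open>Z M = 0\<close> and \<open>U M = I\<close>.
  Multiplying the data equation by them from the right eliminates \<open>A\<close> and \<open>B\<close>.
\<close>
lemma closed_loop_from_data:
  fixes A P :: "real^'n^'n" and B :: "real^'m^'n" and Z Z' W :: "real^'l^'n" and U :: "real^'l^'m"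
    and Y :: "real^'n^'l" and M :: "real^'m^'l" and C :: "real^'n^'q" and D\<^sub>u :: "real^'m^'q"
  assumes data: "Z' + W = A ** Z + B ** U"
    and ZY: "Z ** Y = P" and M: "vcat 0 (mat 1) = vcat Z U ** M"
    and K: "K = U ** Y ** P'" and P': "P' ** P = mat 1"
  shows "(A + B ** K) ** P = Z' ** Y + W ** Y"
    and "hcat B (mat 1) = hcat (Z' ** M) (mat 1) + W ** hcat M 0"
    and "(C + D\<^sub>u ** K) ** P = C ** P + D\<^sub>u ** U ** Y"
proof -
  have KP: "K ** P = U ** Y" by (simp add: K P' matrix_mul_assoc[symmetric])
  have "(A + B ** K) ** P = (A ** Z + B ** U) ** Y"
    by (simp add: mult_matrix_add_rdistrib matrix_mul_assoc[symmetric] KP ZY)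
  then show "(A + B ** K) ** P = Z' ** Y + W ** Y"
    by (simp add: data[symmetric] mult_matrix_add_rdistrib)
  show "(C + D\<^sub>u ** K) ** P = C ** P + D\<^sub>u ** U ** Y"
    by (simp add: mult_matrix_add_rdistrib matrix_mul_assoc[symmetric] KP)
  have "Z ** M = 0" "U ** M = mat 1" using M by (simp_all add: vcat_mult)
  then have "B = (A ** Z + B ** U) ** M"
    by (simp add: mult_matrix_add_rdistrib matrix_mul_assoc[symmetric])
  also have "\<dots> = Z' ** M + W ** M" by (simp add: data[symmetric] mult_matrix_add_rdistrib)
  finally show "hcat B (mat 1) = hcat (Z' ** M) (mat 1) + W ** hcat M 0"
    by (simp add: mult_hcat hcat_add)
qed

section \<open>Robust performance\<close>

lemma periodic_mod:
  assumes "periodic p f"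
  shows "f k = f (k mod p)"
proof -
  have "f (j + i * p) = f j" for i j
    by (induction i) (use assms in \<open>auto simp: periodic_def add.assoc[symmetric] add.commute[of p]\<close>)
  from this[of "k mod p" "k div p"] show ?thesis by simp
qed

theorem corollary3:
  fixes \<phi> :: nat
    and A :: "nat \<Rightarrow> real^'n^'n" and B :: "nat \<Rightarrow> real^'m^'n"
    and u\<^sub>d :: "'l::finite \<Rightarrow> nat \<Rightarrow> real^'m"
    and x\<^sub>d \<zeta>\<^sub>d v\<^sub>d d\<^sub>d :: "'l::finite \<Rightarrow> nat \<Rightarrow> real^'n"
    and U :: "nat \<Rightarrow> real^'l^'m" and Z V D W :: "nat \<Rightarrow> real^'l^'n"
    and C :: "nat \<Rightarrow> real^'n^'q" and D\<^sub>u :: "nat \<Rightarrow> real^'m^'q" and D\<^sub>d :: "nat \<Rightarrow> real^'n^'q"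
    and Q\<^sub>p Qt\<^sub>p :: "nat \<Rightarrow> real^('m + 'n)^('m + 'n)"
    and S\<^sub>p St\<^sub>p :: "nat \<Rightarrow> real^'q^('m + 'n)"
    and R\<^sub>p Rt\<^sub>p :: "nat \<Rightarrow> real^'q^'q"
    and Q\<^sub>r :: "nat \<Rightarrow> real^'n^'n" and S\<^sub>r :: "nat \<Rightarrow> real^'l^'n" and R\<^sub>r :: "nat \<Rightarrow> real^'l^'l"
    and Y :: "nat \<Rightarrow> real^'n^'l" and M :: "nat \<Rightarrow> real^'m^'l" and P :: "nat \<Rightarrow> real^'n^'n"
    and E\<^sub>c\<^sub>l :: "nat \<Rightarrow> real^('m + 'n)^'n" and M\<^sub>b :: "nat \<Rightarrow> real^('m + 'n)^'l"
    and D\<^sub>c\<^sub>l :: "nat \<Rightarrow> real^('m + 'n)^'q"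
    and K :: "nat \<Rightarrow> real^'n^'m"
  assumes "\<phi> > 0"
    and "periodic \<phi> A" and "periodic \<phi> B"
    \<comment> \<open>data\<close>
    and "\<And>j k. k < \<phi> \<Longrightarrow> x\<^sub>d j (k + 1) = A k *v x\<^sub>d j k + B k *v u\<^sub>d j k + d\<^sub>d j k"
    and "\<And>j k. k \<le> \<phi> \<Longrightarrow> \<zeta>\<^sub>d j k = x\<^sub>d j k + v\<^sub>d j k"
    and "\<And>k. k \<le> \<phi> \<Longrightarrow> Z k = of_columns (\<lambda>j. \<zeta>\<^sub>d j k)"
    and "\<And>k. k < \<phi> \<Longrightarrow> U k = of_columns (\<lambda>j. u\<^sub>d j k)"
    and "\<And>k. k \<le> \<phi> \<Longrightarrow> V k = of_columns (\<lambda>j. v\<^sub>d j k)"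
    and "\<And>k. k < \<phi> \<Longrightarrow> D k = of_columns (\<lambda>j. d\<^sub>d j k)"
    and "\<And>k. k < \<phi> \<Longrightarrow> rank (vcat (Z k) (U k)) = CARD('n) + CARD('m)"
    \<comment> \<open>performance output and performance index\<close>
    and "periodic \<phi> C" and "periodic \<phi> D\<^sub>u" and "periodic \<phi> D\<^sub>d"
    and "periodic \<phi> Q\<^sub>p" and "periodic \<phi> S\<^sub>p" and "periodic \<phi> R\<^sub>p"
    and "\<And>k. transpose (Q\<^sub>p k) = Q\<^sub>p k"
    and "\<And>k. transpose (R\<^sub>p k) = R\<^sub>p k"
    and "\<And>k. 0 \<preceq>\<^sub>L R\<^sub>p k"
    and "\<And>k. invertible (block2 (Q\<^sub>p k) (S\<^sub>p k) (transpose (S\<^sub>p k)) (R\<^sub>p k))"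
    and "\<And>k. block2 (Qt\<^sub>p k) (St\<^sub>p k) (transpose (St\<^sub>p k)) (Rt\<^sub>p k) =
           matrix_inv (block2 (Q\<^sub>p k) (S\<^sub>p k) (transpose (S\<^sub>p k)) (R\<^sub>p k))"
    and "\<And>k. Qt\<^sub>p k \<prec>\<^sub>L 0"
    \<comment> \<open>noise bound\<close>
    and "\<And>k. k < \<phi> \<Longrightarrow> W k = A k ** V k - V (k + 1) - D k"
    and "\<And>k. k < \<phi> \<Longrightarrow> transpose (Q\<^sub>r k) = Q\<^sub>r k"
    and "\<And>k. k < \<phi> \<Longrightarrow> transpose (R\<^sub>r k) = R\<^sub>r k"
    and "\<And>k. k < \<phi> \<Longrightarrow> R\<^sub>r k \<prec>\<^sub>L 0"
    and "\<And>k. k < \<phi> \<Longrightarrow>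
           0 \<preceq>\<^sub>L transpose (vcat (mat 1) (transpose (W k)))
               ** block2 (Q\<^sub>r k) (S\<^sub>r k) (transpose (S\<^sub>r k)) (R\<^sub>r k)
               ** vcat (mat 1) (transpose (W k))"
    \<comment> \<open>matrix inequalities\<close>
    and "\<And>k. k < \<phi> \<Longrightarrow> E\<^sub>c\<^sub>l k = hcat (Z (k + 1) ** M k) (mat 1)"
    and "\<And>k. k < \<phi> \<Longrightarrow> M\<^sub>b k = hcat (M k) 0"
    and "\<And>k. D\<^sub>c\<^sub>l k = hcat (D\<^sub>u k) (D\<^sub>d k)"
    and "\<And>k. k \<le> \<phi> \<Longrightarrow> transpose (P k) = P k"
    and "\<And>k. k < \<phi> \<Longrightarrow>
           0 \<prec>\<^sub>L sym_block5
             (P (k + 1) - Q\<^sub>r k)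

             (- (transpose (St\<^sub>p k) ** transpose (E\<^sub>c\<^sub>l k)))
             (- (D\<^sub>c\<^sub>l k ** St\<^sub>p k) - transpose (St\<^sub>p k) ** transpose (D\<^sub>c\<^sub>l k) + Rt\<^sub>p k)

             (- transpose (S\<^sub>r k))
             (- (M\<^sub>b k ** St\<^sub>p k))
             (- R\<^sub>r k)

             (transpose (E\<^sub>c\<^sub>l k))
             (transpose (D\<^sub>c\<^sub>l k))
             (transpose (M\<^sub>b k))
             (- matrix_inv (Qt\<^sub>p k))

             (transpose (Z (k + 1) ** Y k))
             (transpose (C k ** P k + D\<^sub>u k ** U k ** Y k))
             (transpose (Y k))
             0
             (P k)"
    and "\<And>k. k < \<phi> \<Longrightarrow> Z k ** Y k = P k"
    and "\<And>k. k < \<phi> \<Longrightarrow> vcat 0 (mat 1) = vcat (Z k) (U k) ** M k"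
    and "P \<phi> = P 0"
    \<comment> \<open>controller\<close>
    and "\<And>k. k < \<phi> \<Longrightarrow> K k = U k ** Y k ** matrix_inv (P k)"
    and "\<And>k n\<^sub>p. k < \<phi> \<Longrightarrow> K (k + n\<^sub>p * \<phi>) = K k"
  shows "\<exists>\<epsilon>>0. \<forall>w\<in>ell2. \<forall>x z.
           x 0 = 0 \<longrightarrow>
           (\<forall>k. x (k + 1) = (A k + B k ** K k) *v x k + hcat (B k) (mat 1) *v w k) \<longrightarrow>
           (\<forall>k. z k = (C k + D\<^sub>u k ** K k) *v x k + D\<^sub>c\<^sub>l k *v w k) \<longrightarrow>
           summable (\<lambda>k. quad_form (block2 (Q\<^sub>p k) (S\<^sub>p k) (transpose (S\<^sub>p k)) (R\<^sub>p k))
                            (vappend (w k) (z k))) \<and>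
           (\<Sum>k. quad_form (block2 (Q\<^sub>p k) (S\<^sub>p k) (transpose (S\<^sub>p k)) (R\<^sub>p k))
                   (vappend (w k) (z k))) + \<epsilon> * (\<Sum>k. w k \<bullet> w k) \<le> 0"
proof -
  define H where "H k = block2 (Q\<^sub>p k) (S\<^sub>p k) (transpose (S\<^sub>p k)) (R\<^sub>p k)" for k
  define A\<^sub>K where "A\<^sub>K k = A k + B k ** K k" for k
  define B\<^sub>w where "B\<^sub>w k = hcat (B k) (mat 1)" for k
  define C\<^sub>K where "C\<^sub>K k = C k + D\<^sub>u k ** K k" for k
  define s where "s k x w = quad_form (H k) (vappend w (C\<^sub>K k *v x + D\<^sub>c\<^sub>l k *v w))" for k x w
  define v where "v k x = x \<bullet> (matrix_inv (P k) *v x)" for k x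

  have K_mod: "K k = K (k mod \<phi>)" for k
    using assms(37)[of "k mod \<phi>" "k div \<phi>"] assms(1) by simp
  have mod: "A\<^sub>K k = A\<^sub>K (k mod \<phi>)" "B\<^sub>w k = B\<^sub>w (k mod \<phi>)" "C\<^sub>K k = C\<^sub>K (k mod \<phi>)"
    "D\<^sub>c\<^sub>l k = D\<^sub>c\<^sub>l (k mod \<phi>)" "H k = H (k mod \<phi>)" for k
    unfolding A\<^sub>K_def B\<^sub>w_def C\<^sub>K_def H_def assms(30)
    using periodic_mod[OF assms(2), of k] periodic_mod[OF assms(3), of k] periodic_mod[OF assms(11), of k]
      periodic_mod[OF assms(12), of k] periodic_mod[OF assms(13), of k] periodic_mod[OF assms(14), of k]
      periodic_mod[OF assms(15), of k] periodic_mod[OF assms(16), of k] K_mod[of k] by simp_all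
  have P_Suc_mod: "P (Suc k mod \<phi>) = P (Suc (k mod \<phi>))" for k
    using assms(35) by (simp add: mod_Suc)

  (* At the end of the period positivity is inherited from P 0. *)
  have P_pos: "0 < quad_form (P k) x" if "k \<le> \<phi>" "x \<noteq> 0" for k x
    using that assms(1,35) sym_block5_last_block_positive[OF assms(32)]
    by (cases "k = \<phi>") auto
  have P_inv: "P k ** matrix_inv (P k) = mat 1" "matrix_inv (P k) ** P k = mat 1" if "k \<le> \<phi>" for k
    using P_pos[OF that] by (force intro: invertible_matrix_inv invertible_if_definite)+
  have v_nonneg: "0 \<le> v k x" if "k \<le> \<phi>" for k x
  proof -
    have "v k x = quad_form (P k) (matrix_inv (P k) *v x)"
      by (simp add: v_def quad_form_def mult_inverse_vec[OF P_inv(1)[OF that]] inner_commute)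
    then show ?thesis using P_pos[OF that, of "matrix_inv (P k) *v x"]
      by (cases "matrix_inv (P k) *v x = 0") (auto simp: quad_form_def)
  qed

  have dissipation: "\<exists>\<epsilon>>0. \<forall>x w. v (Suc k) (A\<^sub>K k *v x + B\<^sub>w k *v w) - v k x + s k x w
      + \<epsilon> * ((norm x)\<^sup>2 + (norm w)\<^sup>2) \<le> 0" if k: "k < \<phi>" for k
  proof -
    have le: "k \<le> \<phi>" "Suc k \<le> \<phi>" using k by auto
    have "Z (k + 1) + W k = A k ** Z k + B k ** U k"
      using k le assms(4)[OF k] assms(5)[OF le(1)] assms(5)[OF le(2)] assms(23)[OF k]
      by (simp add: assms(6-9) noisy_data_equation)
    note cl = closed_loop_from_data[OF this assms(33)[OF k] assms(34)[OF k] assms(36)[OF k] P_inv(2)[OF le(1)]]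
    have inverse: "block2 (Qt\<^sub>p k) (St\<^sub>p k) (transpose (St\<^sub>p k)) (Rt\<^sub>p k)
        ** block2 (Q\<^sub>p k) (S\<^sub>p k) (transpose (S\<^sub>p k)) (R\<^sub>p k) = mat 1"
      by (simp add: assms(21) invertible_matrix_inv(2)[OF assms(20)])
    show ?thesis
      unfolding v_def s_def H_def A\<^sub>K_def B\<^sub>w_def C\<^sub>K_def
      using robust_dissipation[OF inverse assms(22) P_inv(1) P_inv(1)[OF le(1)] assms(27)[OF k] assms(32)[OF k]
        _ cl(1) cl(3), of "hcat (B k) (mat 1)"] cl(2) le
      by (simp add: assms(28)[OF k] assms(29)[OF k])
  qed
  obtain e where e: "\<And>k. k < \<phi> \<Longrightarrow> e k > 0"
    "\<And>k x w. k < \<phi> \<Longrightarrow> v (Suc k) (A\<^sub>K k *v x + B\<^sub>w k *v w) - v k x + s k x w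
      + e k * ((norm x)\<^sup>2 + (norm w)\<^sup>2) \<le> 0"
    using dissipation by metis
  (* Finitely many phases give constants that are uniform in time. *)
  define \<epsilon> where "\<epsilon> = Min (e ` {..<\<phi>})"
  have \<epsilon>: "\<epsilon> > 0" "\<And>k. k < \<phi> \<Longrightarrow> \<epsilon> \<le> e k" proof -
    have "{..<\<phi>} \<noteq> {}" using assms(1) by auto
    then show "\<epsilon> > 0" using e(1) by (subst \<epsilon>_def, subst Min_gr_iff) auto
  qed (simp add: \<epsilon>_def)

  have "\<forall>k. \<exists>c\<ge>0. \<forall>x w. - s k x w \<le> c * ((norm w)\<^sup>2 + norm w * norm x) \<and>
      \<bar>s k x w\<bar> \<le> c * ((norm x)\<^sup>2 + (norm w)\<^sup>2)"
    unfolding s_def H_def using supply_rate_bounds[OF assms(19)] by blast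
  then obtain c where c: "\<And>k. c k \<ge> 0"
    "\<And>k x w. - s k x w \<le> c k * ((norm w)\<^sup>2 + norm w * norm x)"
    "\<And>k x w. \<bar>s k x w\<bar> \<le> c k * ((norm x)\<^sup>2 + (norm w)\<^sup>2)"
    by metis
  define c\<^sub>m where "c\<^sub>m = Max (c ` {..<\<phi>})"
  have c\<^sub>m: "c k \<le> c\<^sub>m" if "k < \<phi>" for k using that by (simp add: c\<^sub>m_def)
  have "c\<^sub>m \<ge> 0" using c(1)[of 0] c\<^sub>m[OF assms(1)] by simp

  have "summable (\<lambda>k. quad_form (H k) (vappend (w k) (z k))) \<and>
      (\<Sum>k. quad_form (H k) (vappend (w k) (z k))) + \<epsilon> * (\<Sum>k. w k \<bullet> w k) \<le> 0"
    if w: "w \<in> ell2" and x0: "x 0 = 0"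
      and x: "\<forall>k. x (k + 1) = (A k + B k ** K k) *v x k + hcat (B k) (mat 1) *v w k"
      and z: "\<forall>k. z k = (C k + D\<^sub>u k ** K k) *v x k + D\<^sub>c\<^sub>l k *v w k" for w x z
  proof -
    define m where "m k = k mod \<phi>" for k
    have m: "m k < \<phi>" for k using assms(1) by (simp add: m_def)
    have xs: "x (Suc k) = A\<^sub>K (m k) *v x k + B\<^sub>w (m k) *v w k" for k
      using x mod[of k] by (simp add: A\<^sub>K_def B\<^sub>w_def m_def)
    have s: "quad_form (H k) (vappend (w k) (z k)) = s (m k) (x k) (w k)" for k
      using z mod[of k] by (simp add: s_def C\<^sub>K_def m_def)
    have "summable (\<lambda>k. s (m k) (x k) (w k)) \<and>
        (\<Sum>k. s (m k) (x k) (w k)) + \<epsilon> * (\<Sum>k. (norm (w k))\<^sup>2) \<le> 0"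
    proof (rule dissipative_supply_sum[where v = "\<lambda>k. v (m k) (x k)" and a = "\<lambda>k. norm (x k)"])
      show "v (m (Suc k)) (x (Suc k)) - v (m k) (x k) + s (m k) (x k) (w k)
          + \<epsilon> * ((norm (x k))\<^sup>2 + (norm (w k))\<^sup>2) \<le> 0" for k
      proof -
        have "v (m (Suc k)) (x (Suc k)) = v (Suc (m k)) (A\<^sub>K (m k) *v x k + B\<^sub>w (m k) *v w k)"
          by (simp only: v_def m_def P_Suc_mod xs)
        moreover have "\<epsilon> * ((norm (x k))\<^sup>2 + (norm (w k))\<^sup>2) \<le> e (m k) * ((norm (x k))\<^sup>2 + (norm (w k))\<^sup>2)"
          by (intro mult_right_mono \<epsilon>(2) m) simp
        ultimately show ?thesis using e(2)[OF m, of k "x k" "w k"] by linarith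
      qed
      show "- s (m k) (x k) (w k) \<le> c\<^sub>m * ((norm (w k))\<^sup>2 + norm (w k) * norm (x k))" for k
        by (rule order_trans[OF c(2)]) (intro mult_right_mono c\<^sub>m m, simp)
      show "\<bar>s (m k) (x k) (w k)\<bar> \<le> c\<^sub>m * ((norm (x k))\<^sup>2 + (norm (w k))\<^sup>2)" for k
        by (rule order_trans[OF c(3)]) (intro mult_right_mono c\<^sub>m m, simp)
      show "0 \<le> v (m k) (x k)" for k using v_nonneg less_imp_le[OF m] by blast
      show "v (m 0) (x 0) = 0" by (simp add: v_def x0)
    qed (use w \<epsilon>(1) \<open>c\<^sub>m \<ge> 0\<close> in \<open>simp_all add: ell2_def\<close>)
    then show ?thesis by (simp add: s power2_norm_eq_inner)
  qed
  then show ?thesis using \<epsilon>(1) unfolding H_def by blast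
qed

end
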